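(* Fix a precision $(p.q)$ with $p\ge p'$, $q\ge q'$, a step size $\rho\in\mathbb{R}_{(p.q)}$ with $0<\rho\le L^{-1}$, and a tolerance $\hat\epsilon>0$, $\hat\epsilon\in\mathbb{R}_{(p.q)}$. Let $\Omega>0$ satisfy $\|\rho\nabla f(\hat x)-\hat g_\rho(\hat x)\|\le\Omega$ for all $\hat x\in\mathcal{X}_{(p.q)}$ and all problems in $\mathbb{P}$. Let $\delta,\omega,\Theta>0$ be scalars such that, for all problems in $\mathbb{P}$ and all $\hat x^k\in\mathcal{X}_{(p.q)}$ with $\hat d^2(\hat x^k)<\hat\epsilon$, $$\|\hat x^k-\mathcal{T}_\rho(\hat x^k)\|\le\delta,\qquad \|\hat x^{k+1}-\mathcal{T}_\rho(\hat x^k)\|\le\omega,\qquad \|\hat x^k-\hat x^{k+1}\|\le\Theta,$$ where $\hat x^{k+1}=\min\{u,\max\{\ell,\hat x^k-\hat g_\rho(\hat x^k)\}\}$. Let $\epsilon>0$ satisfy $\epsilon\rho\sigma>4\Omega$, and suppose that $\hat d^2(\hat x^k)\ge\hat\epsilon$ implies $\|\hat x^k-\mathcal{T}_\rho(\hat x^k)\|^2\ge\epsilon^2$. Let $\{\hat x^k\}$ be the sequence generated by the fixed-point proximal gradient method applied to a problem of $\mathbb{P}$ with starting point $\hat x^0\in\hat{\mathcal{X}}^0_{(p.q)}$, and let $x^*$ and $f^*$ be the optimal solution and optimal value of that problem. Put $T=\sigma^{-1}(\rho^{-1}+L)$ and $C=\frac{1-\rho\sigma}{1-4\Omega\epsilon^{-1}}$,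 assume $C>0$, let $D>0$ satisfy $D\ge\max_{\hat x\in\hat{\mathcal{X}}^0_{(p.q)}}\|\hat x-x^*\|^2$, and let $k_{\max}$ be a positive integer with $k_{\max}\ge\log\left(\frac{\epsilon^2}{4D}\right)/\log(C)$. Then: (i) If $\hat d^2(\hat x^k)\ge\hat\epsilon$ for all $k\in\{0,\dots,k_{\max}\}$, then $$\|\hat x^{k_{\max}}-x^*\|\le\frac{\epsilon}{2}\quad\text{and}\quad f(\hat x^{k_{\max}})-f^*\le\frac{\epsilon^2-4\Omega\epsilon}{8\rho}.$$ (ii) If $\hat d^2(\hat x^k)<\hat\epsilon$, then $\|\hat x^{k+1}-x^*\|\le\omega+\delta T$ and $$f(\hat x^{k+1})-f^*\le\rho^{-1}\left((\Theta+\Omega)(\omega+\delta T)+\frac12\Theta^2\right).$$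
   Context: Fixed-point sets. $\mathbb{R}^n_{(p.q)}\subset\mathbb{R}^n$ is the set of vectors each of whose components has integer and fractional parts representable with $p$ and $q$ binary digits respectively (plus a sign), i.e. components of the form $m2^{-q}$ with $m\in\mathbb{Z}$, $|m|<2^{p+q}$; similarly for matrices. For $\mathcal{C}\subseteq\mathbb{R}^n$, $\mathcal{C}_{(p.q)}=\mathcal{C}\cap\mathbb{R}^n_{(p.q)}$. $\|\cdot\|$ is the Euclidean norm. Problem family. $\mathbb{P}$ is the family of strongly convex box-constrained QPs $\min_{x\in\mathbb{R}^n} f(x)=\frac12x^\top Qx+c^\top x$ subject to $\ell\le x\le u$ (componentwise), with $Q$ symmetric positive definite in a compact set $\mathbb{Q}\subset\mathbb{R}^{n\times n}_{(p'.q')}$, and $c,\ell,u\in\mathbb{R}^n_{(p'.q')}$ satisfying $c_{\min}\le c\le c_{\max}$, $\ell_{\min}\le\ell\le\ell_{\max}$, $u_{\min}\le u\le u_{\max}$ for fixed bounds in $\mathbb{R}^n_{(p'.q')}$, and $\ell\le u$. For a given problem, $\mathcal{X}=\{x\in\mathbb{R}^n:\ell\le x\le u\}$, $x^*$ is its unique minimizer and $f^*=f(x^* )$. $L,\sigma>0$ are constants valid for every problem in $\mathbb{P}$ such that for all $x,y\in\mathbb{R}^n$: $f(x)\le f(y)+\langle\nabla f(y),x-y\rangle+\frac L2\|x-y\|^2$ and $f(x)\ge f(y)+\langle\nabla f(y),x-y\rangle+\frac\sigma2\|x-y\|^2$. Exact operator. $\mathcal{T}_\rho:\mathcal{X}\to\mathcal{X}$,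 $\mathcal{T}_\rho(x)=\arg\min_{y\in\mathcal{X}}\frac12\|y-(x-\rho\nabla f(x))\|^2=\min\{u,\max\{\ell,x-\rho\nabla f(x)\}\}$ (componentwise). Fixed-point proximal gradient method. Given $\hat x^0\in\hat{\mathcal{X}}^0_{(p.q)}\subseteq\mathcal{X}_{(p.q)}$ (set of possible initial points), iterate for $k=0,1,2,\dots$: $\hat x^{k+1}=\min\{u,\max\{\ell,\hat x^k-\hat g_\rho(\hat x^k)\}\}$, until $\hat d^2(\hat x^k)<\hat\epsilon$ or $k\ge k_{\max}$. Here $\hat g_\rho:\mathcal{X}_{(p.q)}\to\mathbb{R}^n_{(p.q)}$ (depending on the problem) returns the result of evaluating $\rho\nabla f(\cdot)$ in fixed-point arithmetic, and $\hat d^2:\mathcal{X}_{(p.q)}\to\mathbb{R}_{(p.q)}\cap[0,\infty)$ maps $\hat x^k$ to the result of evaluating $\|\hat x^{k+1}-\hat x^k\|^2$ in fixed-point arithmetic; both may be treated as arbitrary such maps subject to the stated bounds. It is assumed throughout that no overflow occurs, so that the subtraction, min and max in the update are exact and $\hat x^k\in\mathcal{X}_{(p.q)}$ for all $k$. *)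

theory Defs
  imports "HOL-Analysis.Analysis"
begin

section \<open>Fixed-point numbers\<close>

text \<open>
  Here \<open>p\<close> and \<open>q\<close> count the binary digits of the integer and of the fractional part; the sign is
  carried separately.
\<close>

definition fp_real :: "nat \<Rightarrow> nat \<Rightarrow> real set" where
  "fp_real p q = {of_int m / 2 ^ q | m::int. \<bar>m\<bar> < 2 ^ (p + q)}"

definition fp_vec :: "nat \<Rightarrow> nat \<Rightarrow> (real ^ 'n) set" where
  "fp_vec p q = {x. \<forall>i. x $ i \<in> fp_real p q}"

definition fp_mat :: "nat \<Rightarrow> nat \<Rightarrow> (real ^ 'n ^ 'm) set" where
  "fp_mat p q = {A. \<forall>i j. A $ i $ j \<in> fp_real p q}"

lemma finite_fp_real: "finite (fp_real p q)"
proof -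
  have "fp_real p q \<subseteq> (\<lambda>m::int. of_int m / 2 ^ q) ` {- (2 ^ (p + q)) .. 2 ^ (p + q)}"
    unfolding fp_real_def by (auto intro!: image_eqI[OF refl])
  then show ?thesis
    by (rule finite_subset) simp
qed

lemma finite_fp_vec: "finite (fp_vec p q :: (real ^ 'n) set)"
proof -
  have "(fp_vec p q :: (real ^ 'n) set)
      \<subseteq> vec_lambda ` (\<Pi>\<^sub>E i\<in>(UNIV :: 'n set). fp_real p q)"
  proof
    fix x :: "real ^ 'n"
    assume "x \<in> fp_vec p q"
    then have "($) x \<in> (\<Pi>\<^sub>E i\<in>(UNIV :: 'n set). fp_real p q)"
      by (auto simp: fp_vec_def)
    moreover have "x = vec_lambda (($) x)" by simp
    ultimately show "x \<in> vec_lambda ` (\<Pi>\<^sub>E i\<in>(UNIV :: 'n set). fp_real p q)" by blast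
  qed
  moreover have "finite (\<Pi>\<^sub>E i\<in>(UNIV :: 'n set). fp_real p q)"
    by (intro finite_PiE finite_fp_real) simp
  ultimately show ?thesis
    by (meson finite_imageI finite_subset)
qed

lemma fp_real_mono:
  assumes "p' \<le> p" "q' \<le> q"
  shows "fp_real p' q' \<subseteq> fp_real p q"
proof
  fix a :: real
  assume "a \<in> fp_real p' q'"
  then obtain m :: int where a: "a = of_int m / 2 ^ q'" and m: "\<bar>m\<bar> < 2 ^ (p' + q')"
    unfolding fp_real_def by auto
  define d where "d = q - q'"
  have q: "q = q' + d" using assms(2) by (simp add: d_def)
  have eq: "a = of_int (m * 2 ^ d) / 2 ^ q"
    by (simp add: a q power_add)
  have "\<bar>m * 2 ^ d\<bar> < 2 ^ (p' + q') * 2 ^ d"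
    using m by (simp add: abs_mult)
  also have "\<dots> = (2::int) ^ (p' + q)" by (simp add: q power_add)
  also have "\<dots> \<le> 2 ^ (p + q)" using assms(1) by (intro power_increasing) auto
  finally show "a \<in> fp_real p q" using eq unfolding fp_real_def by blast
qed


section \<open>Box-constrained quadratic programs\<close>

definition grad :: "('a::real_inner \<Rightarrow> real) \<Rightarrow> 'a \<Rightarrow> 'a" where
  "grad f x = (THE g. GDERIV f x :> g)"

lemma grad_eqI:
  assumes "GDERIV f x :> g"
  shows "grad f x = g"
  unfolding grad_def
proof (rule the_equality)
  fix h
  assume "GDERIV f x :> h"
  then have "(\<lambda>y. y \<bullet> h) = (\<lambda>y. y \<bullet> g)"
    using assms unfolding gderiv_def by (rule has_derivative_unique)
  then have "\<forall>y. y \<bullet> h = y \<bullet> g" by (simp add: fun_eq_iff)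
  then show "h = g" by (rule vector_eq_ldot[THEN iffD1])
qed (rule assms)

record 'n qp =
  qp_Q :: "real ^ 'n ^ 'n"
  qp_c :: "real ^ 'n"
  qp_l :: "real ^ 'n"
  qp_u :: "real ^ 'n"

definition qp_obj :: "('n::finite) qp \<Rightarrow> real ^ 'n \<Rightarrow> real" where
  "qp_obj P x = 1 / 2 * (x \<bullet> (qp_Q P *v x)) + qp_c P \<bullet> x"

definition qp_box :: "('n::finite) qp \<Rightarrow> (real ^ 'n) set" where
  "qp_box P = {qp_l P .. qp_u P}"

definition qp_box_fp :: "nat \<Rightarrow> nat \<Rightarrow> ('n::finite) qp \<Rightarrow> (real ^ 'n) set" where
  "qp_box_fp p q P = qp_box P \<inter> fp_vec p q"

definition pos_def_mat :: "real ^ 'n ^ 'n \<Rightarrow> bool" where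
  "pos_def_mat A \<longleftrightarrow> (\<forall>x. x \<noteq> 0 \<longrightarrow> x \<bullet> (A *v x) > 0)"

definition qp_family ::
  "nat \<Rightarrow> nat \<Rightarrow> (real ^ 'n ^ 'n) set \<Rightarrow> real ^ 'n \<Rightarrow> real ^ 'n \<Rightarrow> real ^ 'n \<Rightarrow> real ^ 'n
    \<Rightarrow> real ^ 'n \<Rightarrow> real ^ 'n \<Rightarrow> ('n::finite) qp set" where
  "qp_family p q QQ cmin cmax lmin lmax umin umax =
     {P. qp_Q P \<in> QQ \<and> transpose (qp_Q P) = qp_Q P \<and> pos_def_mat (qp_Q P) \<and>
         qp_c P \<in> fp_vec p q \<and> qp_l P \<in> fp_vec p q \<and> qp_u P \<in> fp_vec p q \<and>
         cmin \<le> qp_c P \<and> qp_c P \<le> cmax \<and>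
         lmin \<le> qp_l P \<and> qp_l P \<le> lmax \<and>
         umin \<le> qp_u P \<and> qp_u P \<le> umax \<and>
         qp_l P \<le> qp_u P}"

lemma grad_qp_obj:
  assumes "transpose (qp_Q P) = qp_Q P"
  shows "grad (qp_obj P) x = qp_Q P *v x + qp_c P"
proof (rule grad_eqI)
  have sym: "x \<bullet> (qp_Q P *v h) = h \<bullet> (qp_Q P *v x)" for h
    using assms by (metis dot_lmul_matrix inner_commute vector_transpose_matrix)
  have lin: "((*v) (qp_Q P) has_derivative (*v) (qp_Q P)) (at x)"
    by (rule bounded_linear_imp_has_derivative) (rule matrix_vector_mul_bounded_linear)
  have "((\<lambda>x. 1 / 2 * (x \<bullet> (qp_Q P *v x)) + qp_c P \<bullet> x) has_derivative
      (\<lambda>h. 1 / 2 * (x \<bullet> (qp_Q P *v h) + h \<bullet> (qp_Q P *v x)) + qp_c P \<bullet> h)) (at x)"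
    by (rule derivative_eq_intros lin refl | simp)+
  moreover have "(\<lambda>h. 1 / 2 * (x \<bullet> (qp_Q P *v h) + h \<bullet> (qp_Q P *v x)) + qp_c P \<bullet> h)
      = (\<lambda>h. h \<bullet> (qp_Q P *v x + qp_c P))"
    by (simp add: sym inner_add_right inner_commute)
  moreover have "qp_obj P = (\<lambda>x. 1 / 2 * (x \<bullet> (qp_Q P *v x)) + qp_c P \<bullet> x)"
    by (simp add: qp_obj_def fun_eq_iff)
  ultimately show "GDERIV (qp_obj P) x :> qp_Q P *v x + qp_c P"
    unfolding gderiv_def by simp
qed


section \<open>The exact operator and the fixed-point proximal gradient step\<close>

definition prox_op :: "real \<Rightarrow> ('n::finite) qp \<Rightarrow> real ^ 'n \<Rightarrow> real ^ 'n" where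
  "prox_op \<rho> P x =
     arg_min_on (\<lambda>y. 1 / 2 * (norm (y - (x - \<rho> *\<^sub>R grad (qp_obj P) x)))\<^sup>2) (qp_box P)"

definition clip :: "real ^ 'n \<Rightarrow> real ^ 'n \<Rightarrow> real ^ 'n \<Rightarrow> real ^ 'n" where
  "clip l u z = (\<chi> i. min (u $ i) (max (l $ i) (z $ i)))"

text \<open>
  The argument \<open>g\<close> is the computed value of the scaled gradient. In the absence of overflow the
  subtraction and the two clipping operations on fixed-point numbers are exact, so they are the
  real ones here.
\<close>

definition fp_step :: "('n::finite) qp \<Rightarrow> (real ^ 'n \<Rightarrow> real ^ 'n) \<Rightarrow> real ^ 'n \<Rightarrow> real ^ 'n" where
  "fp_step P g x = clip (qp_l P) (qp_u P) (x - g x)"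

lemma prox_op_eq_clip:
  assumes "qp_l P \<le> qp_u P"
  shows "prox_op \<rho> P x = clip (qp_l P) (qp_u P) (x - \<rho> *\<^sub>R grad (qp_obj P) x)"
proof -
  define z where "z = x - \<rho> *\<^sub>R grad (qp_obj P) x"
  define w where "w = clip (qp_l P) (qp_u P) z"
  define F where "F = (\<lambda>y. 1 / 2 * (norm (y - z))\<^sup>2)"
  have lu: "qp_l P $ i \<le> qp_u P $ i" for i using assms by (simp add: less_eq_vec_def)
  have wB: "w \<in> qp_box P"
    using lu by (auto simp: w_def clip_def qp_box_def less_eq_vec_def)
  have F: "F y = 1 / 2 * (\<Sum>i\<in>UNIV. (y $ i - z $ i)\<^sup>2)" for y
    unfolding F_def power2_norm_eq_inner by (simp add: inner_vec_def power2_eq_square)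
  have comp: "(w $ i - z $ i)\<^sup>2 \<le> (y $ i - z $ i)\<^sup>2" if "y \<in> qp_box P" for y i
  proof -
    have "qp_l P $ i \<le> y $ i" "y $ i \<le> qp_u P $ i"
      using that by (auto simp: qp_box_def less_eq_vec_def)
    then have "\<bar>w $ i - z $ i\<bar> \<le> \<bar>y $ i - z $ i\<bar>"
      by (auto simp: w_def clip_def)
    then show ?thesis by (simp add: abs_le_square_iff)
  qed
  have le: "F w \<le> F y" if "y \<in> qp_box P" for y
    using sum_mono[of UNIV "\<lambda>i. (w $ i - z $ i)\<^sup>2" "\<lambda>i. (y $ i - z $ i)\<^sup>2"] comp[OF that]
    by (simp add: F)
  have uniq: "y = w" if "y \<in> qp_box P" "F y \<le> F w" for y
  proof -
    have "(\<Sum>i\<in>UNIV. (y $ i - z $ i)\<^sup>2 - (w $ i - z $ i)\<^sup>2) \<le> 0"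
      using that(2) by (simp add: F sum_subtractf)
    moreover have nn: "0 \<le> (y $ i - z $ i)\<^sup>2 - (w $ i - z $ i)\<^sup>2" for i
      using comp[OF that(1)] by simp
    ultimately have "(\<Sum>i\<in>UNIV. (y $ i - z $ i)\<^sup>2 - (w $ i - z $ i)\<^sup>2) = 0"
      by (intro antisym sum_nonneg) auto
    then have "(y $ i - z $ i)\<^sup>2 - (w $ i - z $ i)\<^sup>2 = 0" for i
      using nn by (subst (asm) sum_nonneg_eq_0_iff) auto
    then have "\<bar>y $ i - z $ i\<bar> = \<bar>w $ i - z $ i\<bar>" for i
      by (simp add: power2_eq_iff abs_eq_iff)
    moreover have "qp_l P $ i \<le> y $ i" "y $ i \<le> qp_u P $ i" for i
      using that(1) by (auto simp: qp_box_def less_eq_vec_def)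
    moreover have "w $ i = min (qp_u P $ i) (max (qp_l P $ i) (z $ i))" for i
      by (simp add: w_def clip_def)
    ultimately have "y $ i = w $ i" for i
      using lu[of i] by (smt (verit, best))
    then show ?thesis by (simp add: vec_eq_iff)
  qed
  have "arg_min_on F (qp_box P) = w"
    unfolding arg_min_on_def arg_min_def is_arg_min_def
  proof (rule some_equality)
    show "w \<in> qp_box P \<and> \<not> (\<exists>y. y \<in> qp_box P \<and> F y < F w)"
      using wB le by (auto simp: not_less)
    show "y = w" if "y \<in> qp_box P \<and> \<not> (\<exists>z. z \<in> qp_box P \<and> F z < F y)" for y
      using that wB uniq by (auto simp: not_less)
  qed
  then show ?thesis by (simp add: prox_op_def F_def z_def w_def)
qed

text \<open>
  Since the box has fixed-point endpoints, every step returns a fixed-point vector, so the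
  representability of all iterates is no separate assumption.
\<close>

lemma fp_step_in_box:
  assumes P: "P \<in> qp_family p' q' QQ cmin cmax lmin lmax umin umax"
    and pq: "p' \<le> p" "q' \<le> q"
    and x: "x \<in> qp_box_fp p q P" and g: "g x \<in> fp_vec p q"
  shows "fp_step P g x \<in> qp_box_fp p q P"
proof -
  have lu: "qp_l P $ i \<le> qp_u P $ i"
    and l: "qp_l P $ i \<in> fp_real p q" and u: "qp_u P $ i \<in> fp_real p q" for i
    using P fp_real_mono[OF pq] by (auto simp: qp_family_def fp_vec_def less_eq_vec_def)
  have "fp_step P g x $ i \<in> fp_real p q" for i
  proof -
    obtain a b :: int where a: "x $ i = of_int a / 2 ^ q" and b: "g x $ i = of_int b / 2 ^ q"
      using x g unfolding qp_box_fp_def fp_vec_def fp_real_def by blast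
    obtain m n :: int where m: "qp_l P $ i = of_int m / 2 ^ q" "\<bar>m\<bar> < 2 ^ (p + q)"
      and n: "qp_u P $ i = of_int n / 2 ^ q" "\<bar>n\<bar> < 2 ^ (p + q)"
      using l[of i] u[of i] unfolding fp_real_def by blast
    have "fp_step P g x $ i = of_int (min n (max m (a - b))) / 2 ^ q"
      by (simp add: fp_step_def clip_def a b m n min_def max_def divide_le_cancel
          flip: diff_divide_distrib of_int_diff)
    moreover have "\<bar>min n (max m (a - b))\<bar> < 2 ^ (p + q)"
    proof -
      have "\<bar>min n (max m k)\<bar> < K" if "m \<le> n" "\<bar>m\<bar> < K" "\<bar>n\<bar> < K" for k K :: int
        using that by linarith
      moreover have "m \<le> n" using lu[of i] by (simp add: m n divide_le_cancel)
      ultimately show ?thesis using m(2) n(2) by blast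
    qed
    ultimately show ?thesis unfolding fp_real_def by blast
  qed
  moreover have "fp_step P g x \<in> qp_box P"
    using lu by (auto simp: fp_step_def clip_def qp_box_def less_eq_vec_def)
  ultimately show ?thesis by (simp add: qp_box_fp_def fp_vec_def)
qed

end

theory Submission
  imports Defs
begin

text \<open>
  With gradient error \<open>e\<close>, one projected step from \<open>z\<close> to \<open>w\<close> obeys
  \<open>2 \<rho> (f w - f x\<^sup>*) \<le> (1 - \<rho> \<sigma>) |z - x\<^sup>*|\<^sup>2 - |w - x\<^sup>*|\<^sup>2 + 2 |e| |w - x\<^sup>*|\<close>.
  For \<open>e = 0\<close> it gives \<open>|\<T> z - x\<^sup>*| \<le> |z - x\<^sup>*|\<close>, so a residual of at least \<open>\<epsilon>\<close> forces
  \<open>|z - x\<^sup>*| \<ge> \<epsilon> / 2\<close>. While the stopping test fails, this lower bound turns the linear error term into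
  a quadratic one, and the squared distance contracts by the factor \<open>C\<close>. Once the test succeeds, an
  error bound \<open>|\<T> z - x\<^sup>*| \<le> T |z - \<T> z|\<close> takes over.
\<close>

section \<open>Projection onto a box and the inexact projected gradient step\<close>

lemma clip_in_box:
  assumes "l \<le> u"
  shows "clip l u z \<in> {l..u}"
  using assms by (auto simp: clip_def less_eq_vec_def)

text \<open>The obtuse-angle property of the projection holds in each coordinate: the residual is
  nonzero only where \<open>z\<close> violates a bound, and there every point of the box lies on the
  opposite side of that bound.\<close>

lemma clip_variational:
  fixes l u z y :: "real ^ 'n"
  assumes "y \<in> {l..u}"
  shows "(z - clip l u z) \<bullet> (y - clip l u z) \<le> 0"
proof -
  have "(z $ i - clip l u z $ i) * (y $ i - clip l u z $ i) \<le> 0" for i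
  proof -
    have "l $ i \<le> y $ i" "y $ i \<le> u $ i"
      using assms by (auto simp: less_eq_vec_def)
    then show ?thesis
      by (auto simp: clip_def min_def max_def mult_le_0_iff)
  qed
  then show ?thesis
    by (auto simp: inner_vec_def intro!: sum_nonpos)
qed

text \<open>\<open>f z\<close> cancels between the upper model at \<open>w\<close> and the lower
  model at \<open>y\<close>, and \<open>proj\<close> bounds the remaining gradient term. The inner
  product \<open>(z - w) \<bullet> (w - y)\<close> is left intact because one application polarizes
  it while another bounds it by Cauchy-Schwarz.\<close>

lemma inexact_projected_step:
  fixes z w y g e :: "'a::real_inner"
  assumes "\<rho> > 0"
    and upper: "f w \<le> f z + g \<bullet> (w - z) + L / 2 * (norm (w - z))\<^sup>2"
    and lower: "f y \<ge> f z + g \<bullet> (y - z) + \<sigma> / 2 * (norm (y - z))\<^sup>2"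
    and proj: "(z - (\<rho> *\<^sub>R g + e) - w) \<bullet> (y - w) \<le> 0"
  shows "\<rho> * (f w - f y) \<le> (z - w) \<bullet> (w - y) - e \<bullet> (w - y)
    + \<rho> * L / 2 * (norm (w - z))\<^sup>2 - \<rho> * \<sigma> / 2 * (norm (y - z))\<^sup>2"
proof -
  have "f w - f y \<le> g \<bullet> (w - y) + L / 2 * (norm (w - z))\<^sup>2 - \<sigma> / 2 * (norm (y - z))\<^sup>2"
    using upper lower by (simp add: inner_diff_right)
  then have "\<rho> * (f w - f y)
      \<le> \<rho> * (g \<bullet> (w - y) + L / 2 * (norm (w - z))\<^sup>2 - \<sigma> / 2 * (norm (y - z))\<^sup>2)"
    using \<open>\<rho> > 0\<close> by (simp add: mult_left_mono)
  also have "\<dots> = \<rho> * (g \<bullet> (w - y)) + \<rho> * L / 2 * (norm (w - z))\<^sup>2 - \<rho> * \<sigma> / 2 * (norm (y - z))\<^sup>2"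
    by (simp add: algebra_simps)
  also have "\<rho> * (g \<bullet> (w - y)) \<le> (z - w) \<bullet> (w - y) - e \<bullet> (w - y)"
    using proj by (simp add: algebra_simps inner_simps)
  finally show ?thesis by simp
qed

text \<open>Polarization turns \<open>(z - w) \<bullet> (w - y)\<close> into squared distances. Its
  term in \<open>norm (w - z)\<close> absorbs the smoothness term because \<rho> L \<le> 1.\<close>

lemma inexact_projected_step_distance:
  fixes z w y g e :: "'a::real_inner"
  assumes "\<rho> > 0" "\<rho> * L \<le> 1" and e: "norm e \<le> \<Omega>"
    and upper: "f w \<le> f z + g \<bullet> (w - z) + L / 2 * (norm (w - z))\<^sup>2"
    and lower: "f y \<ge> f z + g \<bullet> (y - z) + \<sigma> / 2 * (norm (y - z))\<^sup>2"
    and proj: "(z - (\<rho> *\<^sub>R g + e) - w) \<bullet> (y - w) \<le> 0"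
  shows "2 * \<rho> * (f w - f y)
    \<le> (1 - \<rho> * \<sigma>) * (norm (z - y))\<^sup>2 - (norm (w - y))\<^sup>2 + 2 * \<Omega> * norm (w - y)"
proof -
  have polar: "(z - w) \<bullet> (w - y)
      = 1 / 2 * ((norm (z - y))\<^sup>2 - (norm (w - z))\<^sup>2 - (norm (w - y))\<^sup>2)"
    by (simp add: power2_norm_eq_inner inner_simps inner_commute)
  have err: "- (e \<bullet> (w - y)) \<le> \<Omega> * norm (w - y)"
    using norm_cauchy_schwarz[of "- e" "w - y"] mult_right_mono[OF e norm_ge_zero[of "w - y"]]
    by simp
  have "\<rho> * L * (norm (w - z))\<^sup>2 \<le> 1 * (norm (w - z))\<^sup>2"
    using assms(2) by (intro mult_right_mono) auto
  then show ?thesis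
    using inexact_projected_step[where f = f, OF assms(1) upper lower proj] polar err
    by (simp add: algebra_simps norm_minus_commute)
qed

section \<open>First-order optimality and the error bound for the exact operator\<close>

lemma minimizer_variational:
  fixes f :: "'a::real_inner \<Rightarrow> real"
  assumes "convex S" "y \<in> S" and a: "is_arg_min f (\<lambda>x. x \<in> S) a"
    and upper: "\<And>w. f w \<le> f a + g \<bullet> (w - a) + L / 2 * (norm (w - a))\<^sup>2"
  shows "g \<bullet> (y - a) \<ge> 0"
proof (rule tendsto_lowerbound)
  show "((\<lambda>t. g \<bullet> (y - a) + t * (L / 2 * (norm (y - a))\<^sup>2)) \<longlongrightarrow> g \<bullet> (y - a)) (at_right 0)"
    by (auto intro!: tendsto_eq_intros)
  have "0 \<le> g \<bullet> (y - a) + t * (L / 2 * (norm (y - a))\<^sup>2)" if "0 < t" "t < 1" for t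
  proof -
    \<comment> \<open>Convexity keeps \<open>w\<close> feasible. The upper model between
      \<open>a\<close> and \<open>w\<close> has a term linear in \<open>t\<close> and one quadratic
      in \<open>t\<close>; dividing by \<open>t\<close> makes the latter vanish in the limit, so no
      derivative of \<open>f\<close> is involved.\<close>
    define w where "w = a + t *\<^sub>R (y - a)"
    have "w = (1 - t) *\<^sub>R a + t *\<^sub>R y"
      by (simp add: w_def algebra_simps)
    then have "w \<in> S"
      using assms that by (auto simp: is_arg_min_def intro: convexD_alt)
    then have "f a \<le> f w"
      using a by (auto simp: is_arg_min_linorder)
    then have "0 \<le> g \<bullet> (w - a) + L / 2 * (norm (w - a))\<^sup>2"
      using upper[of w] by simp
    also have "\<dots> = t * (g \<bullet> (y - a) + t * (L / 2 * (norm (y - a))\<^sup>2))"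
      using that by (simp add: w_def power_mult_distrib) (simp add: power2_eq_square algebra_simps)
    finally show ?thesis
      using that by (simp add: zero_le_mult_iff)
  qed
  then show "\<forall>\<^sub>F t in at_right 0. 0 \<le> g \<bullet> (y - a) + t * (L / 2 * (norm (y - a))\<^sup>2)"
    unfolding eventually_at_right_field by (intro exI[of _ 1]) auto
qed simp

text \<open>This provides the Lipschitz bound for the gradient of a quadratic: control of the
  quadratic form passes to the bilinear form without recourse to eigenvalues.\<close>

lemma pos_semidef_bilinear_bound:
  fixes A :: "real ^ 'n ^ 'n"
  assumes sym: "transpose A = A"
    and nonneg: "\<And>x. x \<bullet> (A *v x) \<ge> 0"
    and le: "\<And>x. x \<bullet> (A *v x) \<le> L * (norm x)\<^sup>2"
  shows "a \<bullet> (A *v b) \<le> L * norm a * norm b"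
proof (cases "a = 0 \<or> b = 0")
  case False
  have swap: "y \<bullet> (A *v x) = x \<bullet> (A *v y)" for x y
    using sym by (metis dot_lmul_matrix inner_commute vector_transpose_matrix)
  define s t where "s = norm a" and "t = norm b"
  have st: "s > 0" "t > 0"
    using False by (auto simp: s_def t_def)
  \<comment> \<open>Young's inequality, with the two vectors scaled to equal length\<close>
  define x y where "x = t *\<^sub>R a" and "y = s *\<^sub>R b"
  have "0 \<le> (x - y) \<bullet> (A *v (x - y))"
    by (rule nonneg)
  also have "\<dots> = x \<bullet> (A *v x) - 2 * (x \<bullet> (A *v y)) + y \<bullet> (A *v y)"
    using swap[of x y] by (simp add: matrix_vector_mult_diff_distrib inner_simps)
  finally have "2 * (x \<bullet> (A *v y)) \<le> L * (norm x)\<^sup>2 + L * (norm y)\<^sup>2"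
    using le[of x] le[of y] by simp
  then have "(t * s) * (a \<bullet> (A *v b)) \<le> (t * s) * (L * s * t)"
    using st by (simp add: x_def y_def matrix_vector_mult_scaleR power2_eq_square algebra_simps
        flip: s_def t_def)
  then show ?thesis
    using st by (simp add: s_def t_def)
qed auto

text \<open>A quadratic equals its second-order Taylor polynomial, so smoothness and strong
  convexity can be read as bounds on the form of \<open>qp_Q P\<close>.\<close>

lemma qp_obj_expansion:
  assumes "transpose (qp_Q P) = qp_Q P"
  shows "qp_obj P y = qp_obj P z + grad (qp_obj P) z \<bullet> (y - z)
    + 1 / 2 * ((y - z) \<bullet> (qp_Q P *v (y - z)))"
proof -
  have "z \<bullet> (qp_Q P *v y) = y \<bullet> (qp_Q P *v z)"
    using assms by (metis dot_lmul_matrix inner_commute vector_transpose_matrix)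
  then show ?thesis
    unfolding grad_qp_obj[OF assms] qp_obj_def
    by (simp add: matrix_vector_mult_diff_distrib inner_simps inner_commute algebra_simps)
qed

text \<open>Let \<open>y\<close> be the image of \<open>z\<close>. Strong monotonicity bounds
  \<sigma> |y - a|^2 by the gradient difference paired with \<open>y - a\<close>, and optimality of
  \<open>a\<close> discards the gradient at \<open>a\<close>. The gradient at \<open>y\<close>
  splits into the one at \<open>z\<close>, controlled by the projection, and a Lipschitz remainder.
  A factor \<open>norm (y - a)\<close> then cancels, hence the case split.\<close>

lemma prox_op_error_bound:
  fixes P :: "('n::finite) qp"
  assumes sym: "transpose (qp_Q P) = qp_Q P" and lu: "qp_l P \<le> qp_u P"
    and "\<sigma> > 0" "\<rho> > 0"
    and upper: "\<And>y z. qp_obj P y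
      \<le> qp_obj P z + grad (qp_obj P) z \<bullet> (y - z) + L / 2 * (norm (y - z))\<^sup>2"
    and lower: "\<And>y z. qp_obj P y
      \<ge> qp_obj P z + grad (qp_obj P) z \<bullet> (y - z) + \<sigma> / 2 * (norm (y - z))\<^sup>2"
    and a: "is_arg_min (qp_obj P) (\<lambda>y. y \<in> qp_box P) a"
  shows "norm (prox_op \<rho> P z - a) \<le> 1 / \<sigma> * (1 / \<rho> + L) * norm (z - prox_op \<rho> P z)"
proof (cases "prox_op \<rho> P z = a")
  case True
  \<comment> \<open>The left side of the goal is 0, but the right side must be shown nonnegative.
    Comparing the two models along a unit vector forces \<open>L > 0\<close>.\<close>
  have "L / 2 * (norm d)\<^sup>2 \<ge> \<sigma> / 2 * (norm d)\<^sup>2" for d :: "real ^ 'n"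
    using upper[of d 0] lower[of 0 d] lower[where z = 0 and y = d] by simp
  from this[of "axis undefined 1"] have "L > 0"
    using \<open>\<sigma> > 0\<close> by simp
  then show ?thesis
    using True assms by simp
next
  case False
  let ?G = "grad (qp_obj P)"
  define y where "y = prox_op \<rho> P z"
  have y: "y = clip (qp_l P) (qp_u P) (z - \<rho> *\<^sub>R ?G z)"
    unfolding y_def by (rule prox_op_eq_clip[OF lu])
  have aB: "a \<in> {qp_l P..qp_u P}"
    using a by (simp add: is_arg_min_def qp_box_def)
  have yB: "y \<in> qp_box P"
    unfolding y qp_box_def by (rule clip_in_box[OF lu])
  have "convex (qp_box P)"
    by (simp add: qp_box_def flip: interval_cbox_cart)
  then have opt: "?G a \<bullet> (y - a) \<ge> 0"
    using yB a upper by (rule minimizer_variational)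
  have "(z - \<rho> *\<^sub>R ?G z - y) \<bullet> (a - y) \<le> 0"
    unfolding y by (rule clip_variational[OF aB])
  then have "\<rho> * (?G z \<bullet> (y - a)) \<le> (z - y) \<bullet> (y - a)"
    by (simp add: algebra_simps inner_simps)
  also have "\<dots> \<le> norm (z - y) * norm (y - a)"
    by (rule norm_cauchy_schwarz)
  finally have proj: "?G z \<bullet> (y - a) \<le> 1 / \<rho> * norm (z - y) * norm (y - a)"
    using \<open>\<rho> > 0\<close> by (simp add: field_simps)
  \<comment> \<open>With base point 0 the constant and linear terms cancel against those of the
    expansion.\<close>
  have form: "\<sigma> * (norm d)\<^sup>2 \<le> d \<bullet> (qp_Q P *v d)" "d \<bullet> (qp_Q P *v d) \<le> L * (norm d)\<^sup>2" for d
    using upper[of d 0] lower[where z = 0 and y = d] qp_obj_expansion[OF sym, of d 0]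
    by simp_all
  have "0 \<le> d \<bullet> (qp_Q P *v d)" for d
    using form(1)[of d] \<open>\<sigma> > 0\<close> by (smt (verit) mult_nonneg_nonneg zero_le_power2)
  then have lip: "(y - a) \<bullet> (qp_Q P *v (y - z)) \<le> L * norm (y - a) * norm (y - z)"
    using sym form(2) by (intro pos_semidef_bilinear_bound) auto
  \<comment> \<open>Adding the strong convexity inequalities for both orders of \<open>y\<close> and
    \<open>a\<close> cancels the function values.\<close>
  have "\<sigma> * (norm (y - a))\<^sup>2 \<le> (?G y - ?G a) \<bullet> (y - a)"
    using lower[of y a] lower[of a y]
    by (simp add: norm_minus_commute inner_simps)
  also have "\<dots> \<le> ?G y \<bullet> (y - a)"
    using opt by (simp add: inner_diff_left)
  also have "\<dots> = (y - a) \<bullet> (qp_Q P *v (y - z)) + ?G z \<bullet> (y - a)"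
    by (simp add: grad_qp_obj[OF sym] matrix_vector_mult_diff_distrib inner_simps inner_commute)
  also have "\<dots> \<le> L * norm (y - a) * norm (y - z) + 1 / \<rho> * norm (z - y) * norm (y - a)"
    using lip proj by simp
  also have "\<dots> = (1 / \<rho> + L) * norm (z - y) * norm (y - a)"
    by (simp add: norm_minus_commute algebra_simps)
  finally have "\<sigma> * norm (y - a) \<le> (1 / \<rho> + L) * norm (z - y)"
    using False by (simp add: y_def power2_eq_square flip: mult.assoc)
  then show ?thesis
    using \<open>\<sigma> > 0\<close> by (simp add: field_simps flip: y_def)
qed

section \<open>Convergence of the fixed-point iterates\<close>

theorem corollary2:
  fixes p p' q q' :: nat
    and QQ :: "(real ^ 'n ^ 'n) set"
    and cmin cmax lmin lmax umin umax :: "real ^ 'n"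
    and PP :: "'n qp set"
    and L \<sigma> \<rho> \<epsilon>h \<Omega> \<delta> \<omega> \<Theta> \<epsilon> T C D :: real
    and ghat :: "'n qp \<Rightarrow> real ^ 'n \<Rightarrow> real ^ 'n"
    and d2hat :: "'n qp \<Rightarrow> real ^ 'n \<Rightarrow> real"
    and P :: "'n qp"
    and X0 :: "(real ^ 'n) set"
    and x :: "nat \<Rightarrow> real ^ 'n"
    and xstar :: "real ^ 'n"
    and kmax :: nat
  assumes QQ: "compact QQ" "QQ \<subseteq> fp_mat p' q'"
    and bounds: "cmin \<in> fp_vec p' q'" "cmax \<in> fp_vec p' q'" "lmin \<in> fp_vec p' q'"
      "lmax \<in> fp_vec p' q'" "umin \<in> fp_vec p' q'" "umax \<in> fp_vec p' q'"
    and PP: "PP = qp_family p' q' QQ cmin cmax lmin lmax umin umax"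
    and L: "L > 0"
      "\<And>R y z. R \<in> PP \<Longrightarrow>
         qp_obj R y \<le> qp_obj R z + grad (qp_obj R) z \<bullet> (y - z) + L / 2 * (norm (y - z))\<^sup>2"
    and \<sigma>: "\<sigma> > 0"
      "\<And>R y z. R \<in> PP \<Longrightarrow>
         qp_obj R y \<ge> qp_obj R z + grad (qp_obj R) z \<bullet> (y - z) + \<sigma> / 2 * (norm (y - z))\<^sup>2"
    and pq: "p \<ge> p'" "q \<ge> q'"
    and \<rho>: "\<rho> \<in> fp_real p q" "0 < \<rho>" "\<rho> \<le> 1 / L"
    and \<epsilon>h: "\<epsilon>h > 0" "\<epsilon>h \<in> fp_real p q"
    and ghat: "\<And>R. R \<in> PP \<Longrightarrow> ghat R \<in> qp_box_fp p q R \<rightarrow> fp_vec p q"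
    and d2hat: "\<And>R. R \<in> PP \<Longrightarrow> d2hat R \<in> qp_box_fp p q R \<rightarrow> fp_real p q \<inter> {0..}"
    and \<Omega>: "\<Omega> > 0"
      "\<And>R y. R \<in> PP \<Longrightarrow> y \<in> qp_box_fp p q R \<Longrightarrow>
         norm (\<rho> *\<^sub>R grad (qp_obj R) y - ghat R y) \<le> \<Omega>"
    and pos: "\<delta> > 0" "\<omega> > 0" "\<Theta> > 0"
    and \<delta>\<omega>\<Theta>:
      "\<And>R y. R \<in> PP \<Longrightarrow> y \<in> qp_box_fp p q R \<Longrightarrow> d2hat R y < \<epsilon>h \<Longrightarrow>
         norm (y - prox_op \<rho> R y) \<le> \<delta> \<and>
         norm (fp_step R (ghat R) y - prox_op \<rho> R y) \<le> \<omega> \<and>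
         norm (y - fp_step R (ghat R) y) \<le> \<Theta>"
    and \<epsilon>: "\<epsilon> > 0" "\<epsilon> * \<rho> * \<sigma> > 4 * \<Omega>"
      "\<And>R y. R \<in> PP \<Longrightarrow> y \<in> qp_box_fp p q R \<Longrightarrow> d2hat R y \<ge> \<epsilon>h \<Longrightarrow>
         (norm (y - prox_op \<rho> R y))\<^sup>2 \<ge> \<epsilon>\<^sup>2"
    and P: "P \<in> PP"
    and X0: "X0 \<subseteq> qp_box_fp p q P"
    and x: "x 0 \<in> X0" "\<And>k. x (Suc k) = fp_step P (ghat P) (x k)"
    and xstar: "is_arg_min (qp_obj P) (\<lambda>y. y \<in> qp_box P) xstar"
    and T: "T = 1 / \<sigma> * (1 / \<rho> + L)"
    and C: "C = (1 - \<rho> * \<sigma>) / (1 - 4 * \<Omega> / \<epsilon>)" "C > 0"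
    and D: "D > 0" "D \<ge> (MAX y\<in>X0. (norm (y - xstar))\<^sup>2)"
    and kmax: "kmax > 0" "real kmax \<ge> ln (\<epsilon>\<^sup>2 / (4 * D)) / ln C"
  shows
    "((\<forall>k\<in>{0..kmax}. d2hat P (x k) \<ge> \<epsilon>h) \<longrightarrow>
        norm (x kmax - xstar) \<le> \<epsilon> / 2 \<and>
        qp_obj P (x kmax) - qp_obj P xstar \<le> (\<epsilon>\<^sup>2 - 4 * \<Omega> * \<epsilon>) / (8 * \<rho>)) \<and>
     (\<forall>k. d2hat P (x k) < \<epsilon>h \<longrightarrow>
        norm (x (Suc k) - xstar) \<le> \<omega> + \<delta> * T \<and>
        qp_obj P (x (Suc k)) - qp_obj P xstar
          \<le> 1 / \<rho> * ((\<Theta> + \<Omega>) * (\<omega> + \<delta> * T) + 1 / 2 * \<Theta>\<^sup>2))"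
proof -
  let ?f = "qp_obj P" and ?G = "grad (qp_obj P)" and ?B = "qp_box_fp p q P"
  have sym: "transpose (qp_Q P) = qp_Q P" and lu: "qp_l P \<le> qp_u P"
    using P by (auto simp: PP qp_family_def)
  note upper = L(2)[OF P] and lower = \<sigma>(2)[OF P]
  have aB: "xstar \<in> {qp_l P..qp_u P}"
    using xstar by (simp add: is_arg_min_def qp_box_def)
  have xB: "x k \<in> ?B" for k
  proof (induction k)
    case 0
    then show ?case using x(1) X0 by blast
  next
    case (Suc k)
    then show ?case
      using fp_step_in_box[OF P[unfolded PP] pq, of "x k" "ghat P"] ghat[OF P] x(2) by auto
  qed
  have f_ge: "?f y \<ge> ?f xstar" if "y \<in> ?B" for y
    using xstar that by (auto simp: is_arg_min_linorder qp_box_fp_def)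
  \<comment> \<open>The sign makes the computed gradient equal to
    \<open>\<rho> *\<^sub>R ?G (x k) + e k\<close>, as the inexact step inequality requires.\<close>
  define e where "e k = ghat P (x k) - \<rho> *\<^sub>R ?G (x k)" for k
  have e: "norm (e k) \<le> \<Omega>" for k
    using \<Omega>(2)[OF P xB[of k]] by (simp add: e_def norm_minus_commute)
  have proj: "(x k - (\<rho> *\<^sub>R ?G (x k) + e k) - x (Suc k)) \<bullet> (xstar - x (Suc k)) \<le> 0" for k
    unfolding x(2) fp_step_def e_def
    using clip_variational[OF aB, of "x k - ghat P (x k)"] by simp
  define r where "r k = norm (x k - xstar)" for k
  have \<rho>L: "\<rho> * L \<le> 1"
    using \<rho> L(1) by (simp add: field_simps)
  have descent: "2 * \<rho> * (?f (x (Suc k)) - ?f xstar)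
      \<le> (1 - \<rho> * \<sigma>) * (r k)\<^sup>2 - (r (Suc k))\<^sup>2 + 2 * \<Omega> * r (Suc k)" for k
    unfolding r_def
    using \<rho>(2) \<rho>L e upper lower proj by (rule inexact_projected_step_distance)
  have far: "r k \<ge> \<epsilon> / 2" if "d2hat P (x k) \<ge> \<epsilon>h" for k
  proof -
    define y where "y = prox_op \<rho> P (x k)"
    have y: "y = clip (qp_l P) (qp_u P) (x k - \<rho> *\<^sub>R ?G (x k))"
      unfolding y_def by (rule prox_op_eq_clip[OF lu])
    have "y \<in> qp_box P"
      unfolding y qp_box_def by (rule clip_in_box[OF lu])
    then have "0 \<le> 2 * \<rho> * (?f y - ?f xstar)"
      using xstar \<rho>(2) by (auto simp: is_arg_min_linorder)
    moreover have "2 * \<rho> * (?f y - ?f xstar) \<le> (1 - \<rho> * \<sigma>) * (norm (x k - xstar))\<^sup>2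
        - (norm (y - xstar))\<^sup>2 + 2 * 0 * norm (y - xstar)"
      using \<rho>(2) \<rho>L
    proof (rule inexact_projected_step_distance[where f = ?f and e = 0])
      show "(x k - (\<rho> *\<^sub>R ?G (x k) + 0) - y) \<bullet> (xstar - y) \<le> 0"
        using clip_variational[OF aB, of "x k - \<rho> *\<^sub>R ?G (x k)"] by (simp add: y)
    qed (use upper lower in auto)
    ultimately have "(norm (y - xstar))\<^sup>2 \<le> (1 - \<rho> * \<sigma>) * (norm (x k - xstar))\<^sup>2"
      by linarith
    also have "\<dots> \<le> 1 * (norm (x k - xstar))\<^sup>2"
      using \<rho>(2) \<sigma>(1) by (intro mult_right_mono) auto
    finally have "norm (y - xstar) \<le> r k"
      by (simp add: r_def)
    then have "norm (x k - y) \<le> 2 * r k"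
      using norm_triangle_ineq4[of "x k - xstar" "y - xstar"] by (simp add: r_def)
    moreover have "\<epsilon> \<le> norm (x k - y)"
      using \<epsilon>(3)[OF P xB that] by (auto simp: y_def intro: power2_le_imp_le)
    ultimately show ?thesis by simp
  qed

  \<comment> \<open>Positivity of \<open>C\<close> alone would allow both its numerator and its
    denominator to be negative; \<rho> \<sigma> \<le> 1, obtained from a unit vector, rules this
    out.\<close>
  have "\<sigma> / 2 * (norm (axis undefined 1 :: real ^ 'n))\<^sup>2
      \<le> L / 2 * (norm (axis undefined 1 :: real ^ 'n))\<^sup>2"
    using upper[of "axis undefined 1" 0] lower[where z = 0 and y = "axis undefined 1"] by simp
  then have "\<sigma> \<le> L" by simp
  then have \<rho>\<sigma>: "\<rho> * \<sigma> \<le> 1"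
    using \<rho>L mult_left_mono[of \<sigma> L \<rho>] \<rho>(2) by linarith
  define \<eta> where "\<eta> = 1 - 4 * \<Omega> / \<epsilon>"
  \<comment> \<open>This is the assumption \<epsilon> \<rho> \<sigma> > 4 \<Omega> divided by
    \<epsilon>; it places the denominator of \<open>C\<close> above its numerator and so gives
    \<open>C < 1\<close>.\<close>
  have \<eta>_gt: "\<eta> > 1 - \<rho> * \<sigma>"
    using \<epsilon>(1,2) by (simp add: \<eta>_def field_simps)
  then have \<eta>: "\<eta> > 0"
    using \<rho>\<sigma> by simp
  have C\<eta>: "C * \<eta> = 1 - \<rho> * \<sigma>"
    using \<eta> by (simp add: C(1) flip: \<eta>_def)
  then have "C < 1"
    using \<eta>_gt \<eta> by (simp add: C(1) flip: \<eta>_def)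

  \<comment> \<open>Linear contraction while the stopping test fails\<close>
  have part1: "norm (x kmax - xstar) \<le> \<epsilon> / 2 \<and>
      ?f (x kmax) - ?f xstar \<le> (\<epsilon>\<^sup>2 - 4 * \<Omega> * \<epsilon>) / (8 * \<rho>)"
    if "\<forall>k\<in>{0..kmax}. d2hat P (x k) \<ge> \<epsilon>h"
  proof -
    have r_ge: "r k \<ge> \<epsilon> / 2" if "k \<le> kmax" for k
      using far \<open>\<forall>k\<in>_. _\<close> that by simp
    \<comment> \<open>The bound \<epsilon> \<le> 2 r is used at the new iterate, so the last
      contraction relies on the test failing at \<open>kmax\<close> itself.\<close>
    have contract: "(r (Suc k))\<^sup>2 \<le> C * (r k)\<^sup>2" if "Suc k \<le> kmax" for k
    proof -
      have "\<Omega> / \<epsilon> * \<epsilon> * r (Suc k) \<le> \<Omega> / \<epsilon> * (2 * r (Suc k)) * r (Suc k)"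
        using r_ge[OF that] \<Omega>(1) \<epsilon>(1)
        by (intro mult_right_mono mult_left_mono) auto
      then have "2 * \<Omega> * r (Suc k) \<le> 4 * \<Omega> / \<epsilon> * (r (Suc k))\<^sup>2"
        using \<epsilon>(1) by (simp add: power2_eq_square)
      moreover have "0 \<le> 2 * \<rho> * (?f (x (Suc k)) - ?f xstar)"
        using f_ge[OF xB[of "Suc k"]] \<rho>(2) by simp
      ultimately have "\<eta> * (r (Suc k))\<^sup>2 \<le> (1 - \<rho> * \<sigma>) * (r k)\<^sup>2"
        using descent[of k] unfolding \<eta>_def by (simp add: algebra_simps)
      also have "\<dots> = \<eta> * (C * (r k)\<^sup>2)"
        by (simp flip: C\<eta>)
      finally show ?thesis using \<eta> by simp
    qed
    have rate: "(r k)\<^sup>2 \<le> C ^ k * D" if "k \<le> kmax" for k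
      using that
    proof (induction k)
      case 0
      \<comment> \<open>\<open>Max\<close> bounds its elements only on a finite set; there are
        finitely many fixed-point vectors.\<close>
      have "finite X0"
        using X0 finite_fp_vec[of p q] by (auto simp: qp_box_fp_def intro: finite_subset)
      then have "(norm (x 0 - xstar))\<^sup>2 \<le> (MAX y\<in>X0. (norm (y - xstar))\<^sup>2)"
        using x(1) by (intro Max_ge) auto
      then show ?case using D(2) by (simp add: r_def)
    next
      case (Suc k)
      have "(r (Suc k))\<^sup>2 \<le> C * (r k)\<^sup>2"
        using Suc.prems by (rule contract)
      also have "\<dots> \<le> C * (C ^ k * D)"
        using Suc C(2) by (intro mult_left_mono) auto
      finally show ?case by simp
    qed
    have small: "C ^ kmax * D \<le> \<epsilon>\<^sup>2 / 4"
    proof -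
      \<comment> \<open>Since \<open>ln C\<close> is negative, clearing the denominator reverses the
        inequality.\<close>
      have "real kmax * ln C \<le> ln (\<epsilon>\<^sup>2 / (4 * D))"
        using kmax(2) C(2) \<open>C < 1\<close> by (simp add: neg_divide_le_eq)
      then have "ln (C ^ kmax) \<le> ln (\<epsilon>\<^sup>2 / (4 * D))"
        using C(2) by (simp add: ln_realpow)
      then have "C ^ kmax \<le> \<epsilon>\<^sup>2 / (4 * D)"
        using C(2) D(1) \<epsilon>(1) by simp
      then show ?thesis using D(1) by (simp add: field_simps)
    qed
    have "(r kmax)\<^sup>2 \<le> (\<epsilon> / 2)\<^sup>2"
      using rate[of kmax] small by (simp add: power_divide)
    then have "r kmax \<le> \<epsilon> / 2"
      by (rule power2_le_imp_le) (use \<epsilon>(1) in simp)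
    moreover have "?f (x kmax) - ?f xstar \<le> (\<epsilon>\<^sup>2 - 4 * \<Omega> * \<epsilon>) / (8 * \<rho>)"
    proof -
      obtain m where m: "kmax = Suc m"
        using kmax(1) gr0_conv_Suc by blast
      have "2 * \<Omega> \<le> r kmax"
        using r_ge[of kmax] \<eta> \<epsilon>(1) by (simp add: \<eta>_def field_simps)
      then have "2 * \<Omega> * r kmax \<le> (r kmax)\<^sup>2"
        by (simp add: power2_eq_square mult_right_mono r_def)
      \<comment> \<open>Writing 1 - \<rho> \<sigma> as \<open>C * \<eta>\<close> supplies the
        missing power of \<open>C\<close>: the bound at \<open>m\<close> becomes the one at
        \<open>kmax\<close>.\<close>
      then have "2 * \<rho> * (?f (x kmax) - ?f xstar) \<le> \<eta> * (C * (r m)\<^sup>2)"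
        using descent[of m] by (simp add: m mult.assoc mult.left_commute[of C] flip: C\<eta>)
      also have "\<dots> \<le> \<eta> * (C * (C ^ m * D))"
        using rate[of m] m C(2) \<eta> by (intro mult_left_mono) auto
      also have "\<dots> \<le> \<eta> * (\<epsilon>\<^sup>2 / 4)"
        using small \<eta> by (simp add: m mult_left_mono)
      also have "\<dots> = (\<epsilon>\<^sup>2 - 4 * \<Omega> * \<epsilon>) / 4"
        using \<epsilon>(1) by (simp add: \<eta>_def power2_eq_square field_simps)
      finally show ?thesis
        using \<rho>(2) by (simp add: field_simps)
    qed
    ultimately show ?thesis by (simp add: r_def)
  qed

  \<comment> \<open>Accuracy once the stopping test succeeds\<close>
  have part2: "norm (x (Suc k) - xstar) \<le> \<omega> + \<delta> * T \<and>
      ?f (x (Suc k)) - ?f xstar \<le> 1 / \<rho> * ((\<Theta> + \<Omega>) * (\<omega> + \<delta> * T) + 1 / 2 * \<Theta>\<^sup>2)"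
    if "d2hat P (x k) < \<epsilon>h" for k
  proof -
    \<comment> \<open>The exact image serves as intermediate point: \<omega> measures its distance
      to the computed iterate, and the error bound turns \<delta> into its distance to
      \<open>xstar\<close>.\<close>
    define y where "y = prox_op \<rho> P (x k)"
    have b: "norm (x k - y) \<le> \<delta>" "norm (x (Suc k) - y) \<le> \<omega>" "norm (x k - x (Suc k)) \<le> \<Theta>"
      using \<delta>\<omega>\<Theta>[OF P xB that] by (simp_all add: y_def x(2))
    have "T \<ge> 0"
      using \<sigma>(1) \<rho>(2) L(1) by (simp add: T)
    have "norm (y - xstar) \<le> T * norm (x k - y)"
      unfolding T y_def using sym lu \<sigma>(1) \<rho>(2) upper lower xstar by (rule prox_op_error_bound)
    also have "\<dots> \<le> T * \<delta>"
      using b(1) \<open>T \<ge> 0\<close> by (rule mult_left_mono)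
    finally have dist: "norm (x (Suc k) - xstar) \<le> \<omega> + \<delta> * T"
      using b(2) norm_triangle_ineq[of "x (Suc k) - y" "y - xstar"] by (simp add: mult.commute)
    let ?d = "x (Suc k) - xstar"
    \<comment> \<open>The step and the gradient error are joined into one vector of norm at most
      \<Theta> + \<Omega> before Cauchy-Schwarz is applied.\<close>
    have "(x k - x (Suc k)) \<bullet> ?d - e k \<bullet> ?d = (x k - x (Suc k) - e k) \<bullet> ?d"
      by (simp add: inner_diff_left)
    also have "\<dots> \<le> norm (x k - x (Suc k) - e k) * norm ?d"
      by (rule norm_cauchy_schwarz)
    also have "\<dots> \<le> (\<Theta> + \<Omega>) * (\<omega> + \<delta> * T)"
      using norm_triangle_ineq4[of "x k - x (Suc k)" "e k"] e[of k] b(3) dist pos \<Omega>(1)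
      by (intro mult_mono) auto
    finally have lin: "(x k - x (Suc k)) \<bullet> ?d - e k \<bullet> ?d \<le> (\<Theta> + \<Omega>) * (\<omega> + \<delta> * T)" .
    have "\<rho> * L * (norm (x (Suc k) - x k))\<^sup>2 \<le> 1 * \<Theta>\<^sup>2"
      using b(3) \<rho>L by (intro mult_mono power_mono) (auto simp: norm_minus_commute)
    moreover have "0 \<le> \<rho> * \<sigma> / 2 * (norm (xstar - x k))\<^sup>2"
      using \<rho>(2) \<sigma>(1) by simp
    ultimately have "\<rho> * (?f (x (Suc k)) - ?f xstar) \<le> (\<Theta> + \<Omega>) * (\<omega> + \<delta> * T) + 1 / 2 * \<Theta>\<^sup>2"
      using inexact_projected_step[where f = ?f, OF \<rho>(2) upper lower proj, of k] lin by simp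
    then have "?f (x (Suc k)) - ?f xstar \<le> 1 / \<rho> * ((\<Theta> + \<Omega>) * (\<omega> + \<delta> * T) + 1 / 2 * \<Theta>\<^sup>2)"
      using \<rho>(2) by (simp add: field_simps)
    with dist show ?thesis by simp
  qed
  from part1 part2 show ?thesis by blast
qed

end
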